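(* Let $r\geq 2$ and let $\mathcal{A}=(A^j_i)_{i,j=1}^r$ be extremal preferences of $r$ players on cuts of $[0,1]$ into $r$ tiles such that every $A^j_i$ is closed, $\bigcup_{i=1}^r A^j_i=\Delta^{r-1}$ for every $j$, and each $A^j_i$ is disjoint from the facet $\{x_i=0\}$ of $\Delta^{r-1}$. Let $x$ be the (unique) cut admitting an envy-free allocation, and let $\Gamma$ be the bipartite graph with $r$ black vertices (the players) and $r$ white vertices (the tiles), where player $j$ and tile $i$ are joined by an edge iff $x\in A^j_i$. Then $\Gamma$ is a cycle (through all $2r$ vertices).
   Context: The cake is the segment $[0,1]$. A cut is a point $x$ of the standard simplex $\Delta^{r-1}=\{x\in\mathbb{R}^r: x_i\geq 0,\ \sum_i x_i=1\}$; its tiles are the consecutive closed subintervals of $[0,1]$ of lengths $x_1,\dots,x_r$. Preferences are subsets $A^j_i\subseteq\Delta^{r-1}$ with $x\in A^j_i$ meaning that in cut $x$ player $j$ prefers tile $i$. A division is a pair $(x,\pi)$ of a cut and a bijection $\pi$ from players to tiles; it is envy-free if $x\in A^j_{\pi(j)}$ for all $j$. Preferences are extremal if they admit exactly two distinct envy-free divisions; for extremal preferences (in this setting) there is exactly one cut admitting an envy-free allocation. *)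

theory Defs
  imports "HOL-Analysis.Analysis"
begin

text \<open>
  The \<open>r\<close> players and the \<open>r\<close> tiles are both indexed by a finite type \<open>'r\<close> with
  \<open>CARD('r) = r\<close>. A cut is identified with the vector of lengths of its tiles, \<open>x $ i\<close> being the
  length of tile \<open>i\<close>. The left-to-right order of the tiles in the cake does not enter any of the
  notions below, so \<open>'r\<close> carries no order.
\<close>

definition cuts :: "(real ^ 'r::finite) set" where
  "cuts = {x. (\<forall>i. 0 \<le> x $ i) \<and> (\<Sum>i\<in>UNIV. x $ i) = 1}"

definition facet :: "'r::finite \<Rightarrow> (real ^ 'r) set" where
  "facet i = {x \<in> cuts. x $ i = 0}"

text \<open>\<open>x \<in> A j i\<close> means that in the cut \<open>x\<close> player \<open>j\<close> prefers tile \<open>i\<close>.\<close>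

type_synonym 'r preferences = "'r \<Rightarrow> 'r \<Rightarrow> (real ^ 'r) set"

definition preferences :: "('r::finite) preferences \<Rightarrow> bool" where
  "preferences A \<longleftrightarrow> (\<forall>j i. A j i \<subseteq> cuts)"

definition envy_free_divisions :: "('r::finite) preferences \<Rightarrow> ((real ^ 'r) \<times> ('r \<Rightarrow> 'r)) set" where
  "envy_free_divisions A = {(x, \<pi>). x \<in> cuts \<and> bij \<pi> \<and> (\<forall>j. x \<in> A j (\<pi> j))}"

definition admits_envy_free_allocation :: "('r::finite) preferences \<Rightarrow> real ^ 'r \<Rightarrow> bool" where
  "admits_envy_free_allocation A x \<longleftrightarrow> (\<exists>\<pi>. (x, \<pi>) \<in> envy_free_divisions A)"

definition extremal :: "('r::finite) preferences \<Rightarrow> bool" where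
  "extremal A \<longleftrightarrow> card (envy_free_divisions A) = 2"

text \<open>
  The preference graph at a cut has vertex set \<open>UNIV :: ('r + 'r) set\<close>: \<open>Inl j\<close> is the black vertex
  of player \<open>j\<close> and \<open>Inr i\<close> is the white vertex of tile \<open>i\<close>. Edges are two-element sets.
\<close>

definition preference_edges :: "('r::finite) preferences \<Rightarrow> real ^ 'r \<Rightarrow> ('r + 'r) set set" where
  "preference_edges A x = {{Inl j, Inr i} | j i. x \<in> A j i}"

text \<open>
  The simple graph with vertex set \<open>V\<close> and edge set \<open>E\<close> is, as a whole, a cycle: \<open>vs\<close> lists all the
  vertices without repetition and the edges are exactly the cyclically consecutive pairs, so there
  are neither further vertices nor chords.
\<close>

definition is_cycle_graph :: "'v set \<Rightarrow> 'v set set \<Rightarrow> bool" where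
  "is_cycle_graph V E \<longleftrightarrow>
     (\<exists>vs. 3 \<le> length vs \<and> distinct vs \<and> set vs = V \<and>
        E = {{vs ! k, vs ! (Suc k mod length vs)} | k. k < length vs})"

end

theory Submission
  imports Defs
begin

text \<open>
  For small \<open>\<epsilon>\<close>, a partition of unity supported in the \<open>\<epsilon>\<close>-neighbourhoods of the sets \<open>A j i\<close> assigns
  to every cut a row-stochastic matrix. Its vector of column sums equals \<open>(1, \<dots>, 1)\<close> only where the
  matrix is doubly stochastic, hence only near an envy-free cut by Hall's theorem, and by Brouwer any
  map of this kind with the right behaviour on the facets takes the value \<open>(1, \<dots>, 1)\<close>. Suppose at an
  isolated envy-free cut \<open>x\<close> some proper nonempty set of players \<open>S\<close> likes only a set \<open>T\<close> of at most
  \<open>|S|\<close> tiles. Near \<open>x\<close> the column sums over \<open>T\<close> then add up to at least \<open>|S|\<close>, so a bump that pushes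
  mass into \<open>T\<close> removes the value \<open>(1, \<dots>, 1)\<close> near \<open>x\<close>. This cannot happen at all envy-free cuts
  simultaneously, so at one of them Hall's condition is strict for all such \<open>S\<close>. Then every edge of
  the preference graph lies in a perfect matching; with only two perfect matchings \<open>\<pi>\<close>, \<open>\<sigma>\<close> the graph
  is \<open>\<pi> \<union> \<sigma>\<close>, and an orbit of \<open>\<pi>\<^sup>-\<^sup>1 \<sigma>\<close> violates strictness unless it contains all players.
\<close>

section \<open>Hall's theorem and doubly stochastic matrices\<close>

text \<open>A strict surplus in Hall's condition survives the loss of one tile; this is what allows
  an edge to be fixed before the others are matched.\<close>

lemma card_le_card_UN_remove:
  assumes "card K < card (\<Union>(N ` K))"
  shows "card K \<le> card (\<Union>k\<in>K. N k - {a})"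
proof -
  have "(\<Union>k\<in>K. N k - {a}) = \<Union>(N ` K) - {a}" by auto
  moreover have "card (\<Union>(N ` K)) - 1 \<le> card (\<Union>(N ` K) - {a})"
    using card_Diff_singleton_if[of "\<Union>(N ` K)" a] by (auto split: if_splits)
  ultimately show ?thesis using assms by simp
qed

text \<open>The Halmos-Vaughan induction. If some proper nonempty \<open>J\<close> is tight, match
  \<open>J\<close> first and send the rest outside its neighbourhood; otherwise any edge may be
  fixed.\<close>

lemma hall_marriage:
  assumes "finite I" "\<And>i. i \<in> I \<Longrightarrow> finite (N i)"
    and "\<And>J. J \<subseteq> I \<Longrightarrow> card J \<le> card (\<Union>(N ` J))"
  shows "\<exists>f. inj_on f I \<and> (\<forall>i\<in>I. f i \<in> N i)"
  using assms
proof (induction I arbitrary: N rule: finite_psubset_induct)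
  case (psubset I)
  note fin = psubset.prems(1) and hall = psubset.prems(2)
  have finU: "finite (\<Union>(N ` J))" if "J \<subseteq> I" for J
    using that fin psubset.hyps by (meson finite_UN finite_subset subsetD)
  show ?case
  proof (cases "\<exists>J. J \<noteq> {} \<and> J \<subset> I \<and> card (\<Union>(N ` J)) \<le> card J")
    case True
    then obtain J where J: "J \<noteq> {}" "J \<subset> I" "card (\<Union>(N ` J)) \<le> card J" by blast
    define U where "U = \<Union>(N ` J)"
    obtain f where f: "inj_on f J" "\<forall>i\<in>J. f i \<in> N i"
      using psubset.IH[of J N] J(2) fin hall by (meson psubsetD psubset_imp_subset subset_trans)
    have "\<exists>g. inj_on g (I - J) \<and> (\<forall>i\<in>I - J. g i \<in> N i - U)"
    proof (rule psubset.IH)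
      show "I - J \<subset> I" using J by blast
      show "finite (N i - U)" if "i \<in> I - J" for i using fin that by blast
      fix K assume K: "K \<subseteq> I - J"
      \<comment> \<open>Hall's condition survives the removal of \<open>U\<close>: apply it to
        \<open>K \<union> J\<close> and subtract \<open>card U \<le> card J\<close>.\<close>
      have "card K + card J = card (K \<union> J)"
        using K J(2) psubset.hyps by (subst card_Un_disjoint) (auto intro: finite_subset)
      also have "\<dots> \<le> card (\<Union>(N ` (K \<union> J)))"
        using K J(2) by (intro hall) auto
      also have "\<Union>(N ` (K \<union> J)) = (\<Union>i\<in>K. N i - U) \<union> U"
        unfolding U_def by auto
      also have "card \<dots> \<le> card (\<Union>i\<in>K. N i - U) + card U"
        by (rule card_Un_le)
      also have "card U \<le> card J" using J(3) U_def by simp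
      finally show "card K \<le> card (\<Union>i\<in>K. N i - U)" by simp
    qed
    then obtain g where g: "inj_on g (I - J)" "\<forall>i\<in>I - J. g i \<in> N i - U" by blast
    have fU: "f i \<in> U" if "i \<in> J" for i using f that U_def by blast
    have gU: "g i \<notin> U" if "i \<in> I" "i \<notin> J" for i using g that by blast
    let ?h = "\<lambda>i. if i \<in> J then f i else g i"
    have "inj_on ?h I"
    proof (rule inj_onI)
      fix a b assume "a \<in> I" "b \<in> I" "?h a = ?h b"
      then show "a = b"
        using fU[of a] fU[of b] gU[of a] gU[of b] inj_onD[OF f(1), of a b] inj_onD[OF g(1), of a b]
        by (auto split: if_splits)
    qed
    moreover have "\<forall>i\<in>I. ?h i \<in> N i" using f g by auto
    ultimately show ?thesis by blast
  next
    case False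
    then have strict: "card J < card (\<Union>(N ` J))" if "J \<noteq> {}" "J \<subset> I" for J
      using that by (meson linorder_not_le)
    show ?thesis
    proof (cases "I = {}")
      case True
      then show ?thesis by simp
    next
      case False
      then obtain i where i: "i \<in> I" by blast
      have "N i \<noteq> {}" using hall[of "{i}"] i by auto
      then obtain a where a: "a \<in> N i" by blast
      have "\<exists>g. inj_on g (I - {i}) \<and> (\<forall>k\<in>I - {i}. g k \<in> N k - {a})"
      proof (rule psubset.IH)
        show "I - {i} \<subset> I" using i by blast
        show "finite (N k - {a})" if "k \<in> I - {i}" for k using fin that by blast
        fix K assume K: "K \<subseteq> I - {i}"
        show "card K \<le> card (\<Union>k\<in>K. N k - {a})"
        proof (cases "K = {}")
          case False
          moreover have "K \<subset> I" using K i by blast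
          ultimately have "card K < card (\<Union>(N ` K))" using strict by blast
          then show ?thesis by (rule card_le_card_UN_remove)
        qed simp
      qed
      then obtain g where g: "inj_on g (I - {i})" "\<forall>k\<in>I - {i}. g k \<in> N k - {a}" by blast
      have "inj_on (g(i := a)) I"
        using g by (auto simp: inj_on_def)
      moreover have "\<forall>k\<in>I. (g(i := a)) k \<in> N k" using g a by auto
      ultimately show ?thesis by blast
    qed
  qed
qed

text \<open>Double counting verifies Hall's condition: the rows in \<open>J\<close> carry mass
  \<open>card J\<close>, all of it in the columns \<open>?T\<close>, whose total mass is
  \<open>card ?T\<close>.\<close>

lemma doubly_stochastic_support_matching:
  fixes f :: "'r::finite \<Rightarrow> 'r \<Rightarrow> real"
  assumes nn: "\<And>j i. 0 \<le> f j i"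
    and row: "\<And>j. (\<Sum>i\<in>UNIV. f j i) = 1"
    and col: "\<And>i. (\<Sum>j\<in>UNIV. f j i) = 1"
  obtains \<pi> where "bij \<pi>" "\<And>j. 0 < f j (\<pi> j)"
proof -
  have "\<exists>\<pi>. inj_on \<pi> UNIV \<and> (\<forall>j\<in>UNIV. \<pi> j \<in> {i. 0 < f j i})"
  proof (rule hall_marriage)
    fix J :: "'r set"
    let ?T = "\<Union>j\<in>J. {i. 0 < f j i}"
    have "real (card J) = (\<Sum>j\<in>J. \<Sum>i\<in>UNIV. f j i)" by (simp add: row)
    also have "\<dots> = (\<Sum>j\<in>J. \<Sum>i\<in>?T. f j i)"
    proof (rule sum.cong[OF refl], rule sum.mono_neutral_right)
      fix j assume "j \<in> J"
      then show "\<forall>i\<in>UNIV - ?T. f j i = 0" using nn[of j] by (force simp: order_less_le)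
    qed auto
    also have "\<dots> = (\<Sum>i\<in>?T. \<Sum>j\<in>J. f j i)" by (rule sum.swap)
    also have "\<dots> \<le> (\<Sum>i\<in>?T. \<Sum>j\<in>UNIV. f j i)"
      by (intro sum_mono sum_mono2) (auto simp: nn)
    also have "\<dots> = real (card ?T)" by (simp add: col)
    finally show "card J \<le> card ?T" by simp
  qed auto
  then obtain \<pi> where "inj \<pi>" "\<And>j. 0 < f j (\<pi> j)" by auto
  then show thesis using that finite_UNIV_inj_surj[of \<pi>] by (auto simp: bij_def)
qed

section \<open>The simplex of cuts and Brouwer's theorem\<close>

lemma
  shows convex_cuts: "convex (cuts :: (real ^ 'r::finite) set)"
    and compact_cuts: "compact (cuts :: (real ^ 'r::finite) set)"
    and axis_in_cuts: "axis i 1 \<in> (cuts :: (real ^ 'r::finite) set)"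
proof -
  show "convex (cuts :: (real ^ 'r) set)"
    unfolding convex_def cuts_def
    by (auto simp: sum.distrib simp flip: sum_distrib_left)
  show "axis i 1 \<in> (cuts :: (real ^ 'r) set)"
    by (auto simp: cuts_def axis_def)
  have "closed (cuts :: (real ^ 'r) set)"
    unfolding cuts_def
    by (intro closed_Collect_conj closed_Collect_all closed_Collect_le closed_Collect_eq continuous_intros)
  moreover have "bounded (cuts :: (real ^ 'r) set)"
    unfolding bounded_iff
  proof (intro exI ballI)
    fix z :: "real ^ 'r" assume "z \<in> cuts"
    then show "norm z \<le> 1" using norm_le_l1_cart[of z] by (simp add: cuts_def)
  qed
  ultimately show "compact (cuts :: (real ^ 'r) set)" by (simp add: compact_eq_bounded_closed)
qed

text \<open>As in Nash's existence proof, \<open>g\<close> lengthens, before renormalising, the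
  tiles whose value \<open>c z i\<close> falls short of 1, and Brouwer applies to
  \<open>g\<close>.\<close>

lemma cuts_map_hits_ones:
  fixes c :: "real ^ 'r::finite \<Rightarrow> 'r \<Rightarrow> real"
  assumes cont: "\<And>i. continuous_on cuts (\<lambda>z. c z i)"
    and sum: "\<And>z. z \<in> cuts \<Longrightarrow> (\<Sum>i\<in>UNIV. c z i) = CARD('r)"
    and face: "\<And>z i. z \<in> facet i \<Longrightarrow> c z i < 1"
  obtains z where "z \<in> cuts" "\<And>i. c z i = 1"
proof -
  \<comment> \<open>At a fixed point of \<open>g\<close> with \<open>H z > 0\<close>, no coordinate of \<open>z\<close> vanishes and all \<open>c z i\<close> are below 1.\<close>
  define h where "h z i = max 0 (1 - c z i)" for z i
  define H where "H z = (\<Sum>i\<in>UNIV. h z i)" for z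
  define g where "g z = (\<chi> i. (z $ i + h z i) / (1 + H z))" for z
  have h0: "0 \<le> h z i" for z i by (simp add: h_def)
  have H0: "0 \<le> H z" for z by (simp add: H_def h0 sum_nonneg)
  have H1: "1 + H z \<noteq> 0" for z using H0[of z] by simp
  have "(cuts :: (real ^ 'r) set) \<noteq> {}" using axis_in_cuts by blast
  moreover have "continuous_on cuts g"
      unfolding g_def H_def h_def using cont H1[unfolded H_def h_def]
      by (intro continuous_intros) auto
  moreover have "g \<in> cuts \<rightarrow> cuts"
  proof
    fix z :: "real ^ 'r" assume z: "z \<in> cuts"
    have "(\<Sum>i\<in>UNIV. z $ i + h z i) = 1 + H z"
      using z by (simp add: sum.distrib cuts_def H_def)
    then show "g z \<in> cuts"
      using z h0 H0[of z] H1[of z]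
      by (auto simp: cuts_def g_def simp flip: sum_divide_distrib)
  qed
  ultimately obtain z where z: "z \<in> cuts" "g z = z"
    using brouwer[OF compact_cuts convex_cuts] by metis
  have fp: "h z i = z $ i * H z" for i
  proof -
    have "(z $ i + h z i) / (1 + H z) = z $ i"
      using z(2) by (simp add: g_def vec_eq_iff)
    then show ?thesis using H1[of z] by (simp add: field_simps)
  qed
  have "H z = 0"
  proof (rule ccontr)
    assume "H z \<noteq> 0"
    then have Hp: "0 < H z" using H0[of z] by simp
    have "c z i < 1" for i
    proof (cases "z $ i = 0")
      case True
      then show ?thesis using face z(1) by (simp add: facet_def)
    next
      case False
      then have "0 < z $ i" using z(1) by (simp add: cuts_def order_less_le)
      then have "0 < h z i" using Hp fp by simp
      then show ?thesis by (simp add: h_def max_def split: if_splits)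
    qed
    then have "(\<Sum>i\<in>UNIV. c z i) < (\<Sum>i\<in>(UNIV :: 'r set). 1)"
      by (intro sum_strict_mono) auto
    then show False using sum[OF z(1)] by simp
  qed
  then have "h z i = 0" for i using fp by simp
  then have ge: "1 \<le> c z i" for i using h_def[of z i] by (simp add: max_def split: if_splits)
  have "(\<Sum>i\<in>UNIV. c z i - 1) = 0" using sum[OF z(1)] by (simp add: sum_subtractf)
  then have "c z i = 1" for i
    using ge by (subst (asm) sum_nonneg_eq_0_iff) auto
  with z(1) that show thesis by blast
qed

section \<open>A cut at which Hall's condition is strict\<close>

text \<open>The sum of the distances is continuous and vanishes only on the common intersection, so
  it has a positive minimum on \<open>K\<close>; at each point some distance is at least the
  average.\<close>

lemma compact_infdist_lower_bound:
  fixes B :: "'j::finite \<Rightarrow> 'a::metric_space set"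
  assumes "compact K" "\<And>j. closed (B j)" "\<And>j. B j \<noteq> {}" "K \<inter> (\<Inter>j. B j) = {}"
  obtains e where "0 < e" "\<And>z. z \<in> K \<Longrightarrow> \<exists>j. e \<le> infdist z (B j)"
proof (cases "K = {}")
  case True
  then show thesis using that[of 1] by simp
next
  case False
  let ?m = "\<lambda>z. \<Sum>j\<in>UNIV. infdist z (B j)"
  have "continuous_on K ?m" by (intro continuous_intros)
  then obtain y where y: "y \<in> K" "\<And>z. z \<in> K \<Longrightarrow> ?m y \<le> ?m z"
    using continuous_attains_inf[OF assms(1) False, of ?m] by blast
  have "\<exists>j. infdist y (B j) \<noteq> 0"
  proof (rule ccontr)
    assume "\<not> ?thesis"
    then have "y \<in> B j" for j using in_closed_iff_infdist_zero[OF assms(2,3), of y j] by simp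
    then show False using y(1) assms(4) by blast
  qed
  then have pos: "0 < ?m y"
    by (auto simp: order_less_le sum_nonneg infdist_nonneg sum_nonneg_eq_0_iff)
  show thesis
  proof (rule that[of "?m y / CARD('j)"])
    show "0 < ?m y / CARD('j)" using pos by simp
    fix z assume z: "z \<in> K"
    show "\<exists>j. ?m y / CARD('j) \<le> infdist z (B j)"
    proof (rule ccontr)
      assume "\<not> ?thesis"
      then have "?m z < (\<Sum>j\<in>(UNIV :: 'j set). ?m y / CARD('j))"
        by (intro sum_strict_mono) (auto simp: not_le)
      then show False using y(2)[OF z] by simp
    qed
  qed
qed


lemma ex_cut_strict_hall:
  fixes A :: "('r::finite) preferences"
  assumes fin: "finite {x. admits_envy_free_allocation A x}"
    and closed: "\<And>j i. closed (A j i)"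
    and cover: "\<And>j. (\<Union>i. A j i) = cuts"
    and facets: "\<And>j i. A j i \<inter> facet i = {}"
  shows "\<exists>x. admits_envy_free_allocation A x \<and>
    (\<forall>S. S \<noteq> {} \<longrightarrow> S \<noteq> UNIV \<longrightarrow> card S < card (\<Union>j\<in>S. {i. x \<in> A j i}))"
proof (rule ccontr)
  assume neg: "\<not> ?thesis"
  define X where "X = {x. admits_envy_free_allocation A x}"
  have XI: "z \<in> X" if "z \<in> cuts" "bij \<pi>" "\<And>j. z \<in> A j (\<pi> j)" for z \<pi>
    using that unfolding X_def admits_envy_free_allocation_def envy_free_divisions_def by blast
  have XD: "\<exists>j. x \<in> A j i" if "x \<in> X" for x i
    using that unfolding X_def admits_envy_free_allocation_def envy_free_divisions_def
    by simp (metis bij_pointE)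
  have Xcuts: "X \<subseteq> cuts"
    unfolding X_def admits_envy_free_allocation_def envy_free_divisions_def by blast
  \<comment> \<open>Needed because \<open>infdist z {} = 0\<close>.\<close>
  have ne: "A j i \<noteq> {}" for j i
  proof -
    obtain k where k: "axis i 1 \<in> A j k" using cover axis_in_cuts by blast
    then have "(axis i 1 :: real ^ 'r) \<notin> facet k" using facets by blast
    then have "k = i" using axis_in_cuts[of i] by (auto simp: facet_def axis_def split: if_splits)
    then show ?thesis using k by blast
  qed
  \<comment> \<open>The neighbourhood of \<open>S\<close> is nonempty because every player likes
    some tile, and proper because it has at most \<open>card S < CARD('r)\<close> elements; hence
    \<open>t\<close> inside and \<open>u\<close> outside exist.\<close>
  have "\<exists>S t u. card (\<Union>j\<in>S. {i. x \<in> A j i}) \<le> card S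
      \<and> t \<in> (\<Union>j\<in>S. {i. x \<in> A j i}) \<and> u \<notin> (\<Union>j\<in>S. {i. x \<in> A j i})" if "x \<in> X" for x
  proof -
    obtain S where S: "S \<noteq> {}" "S \<noteq> UNIV" "card (\<Union>j\<in>S. {i. x \<in> A j i}) \<le> card S"
      using neg \<open>x \<in> X\<close> unfolding X_def not_less[symmetric] by blast
    let ?T = "\<Union>j\<in>S. {i. x \<in> A j i}"
    have "card S < CARD('r)" using S(2) by (simp add: psubset_card_mono psubsetI)
    then have "?T \<noteq> UNIV" using S(3) by auto
    moreover have "?T \<noteq> {}"
    proof -
      obtain j where "j \<in> S" using S(1) by blast
      moreover obtain i where "x \<in> A j i" using cover[of j] Xcuts \<open>x \<in> X\<close> by blast
      ultimately show ?thesis by blast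
    qed
    ultimately show ?thesis using S(3) by blast
  qed
  then obtain S t u where Stu: "\<And>x. x \<in> X \<Longrightarrow> card (\<Union>j\<in>S x. {i. x \<in> A j i}) \<le> card (S x)"
    "\<And>x. x \<in> X \<Longrightarrow> t x \<in> (\<Union>j\<in>S x. {i. x \<in> A j i})"
    "\<And>x. x \<in> X \<Longrightarrow> u x \<notin> (\<Union>j\<in>S x. {i. x \<in> A j i})"
    by metis
  define T where "T x = (\<Union>j\<in>S x. {i. x \<in> A j i})" for x
  \<comment> \<open>The direction \<open>e\<^sub>t - e\<^sub>u\<close> in which the column sums are pushed near \<open>x\<close>.\<close>
  define d :: "real ^ 'r \<Rightarrow> 'r \<Rightarrow> real" where "d x i = of_bool (i = t x) - of_bool (i = u x)" for x i
  have d0: "(\<Sum>i\<in>UNIV. d x i) = 0" for x by (simp add: d_def sum_subtractf)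
  have d1: "(\<Sum>i\<in>T x. d x i) = 1" if "x \<in> X" for x
    using Stu(2,3)[OF that] by (simp add: d_def sum_subtractf T_def of_bool_def)
  \<comment> \<open>This margin makes both the weights of tile \<open>i\<close> and all bumps vanish
    on \<open>facet i\<close>. The index type \<open>unit\<close> below reduces the compactness
    bound to a single set.\<close>
  obtain e1 where e1: "0 < e1" "\<And>j i z. z \<in> facet i \<Longrightarrow> e1 \<le> infdist z (A j i)"
  proof -
    have "\<forall>p. \<exists>e>0. \<forall>z\<in>facet (snd p). e \<le> infdist z (A (fst p) (snd p))"
    proof
      fix p :: "'r \<times> 'r"
      have "facet (snd p) = cuts \<inter> {z. z $ snd p = 0}" by (auto simp: facet_def)
      moreover have "closed {z :: real ^ 'r. z $ snd p = 0}"
        by (intro closed_Collect_eq continuous_intros)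
      ultimately have "compact (facet (snd p))" by (metis compact_Int_closed compact_cuts)
      moreover have "facet (snd p) \<inter> (\<Inter>_::unit. A (fst p) (snd p)) = {}" using facets by auto
      ultimately show "\<exists>e>0. \<forall>z\<in>facet (snd p). e \<le> infdist z (A (fst p) (snd p))"
        using compact_infdist_lower_bound[of "facet (snd p)" "\<lambda>_::unit. A (fst p) (snd p)"] closed ne
        by (metis (no_types, lifting))
    qed
    then obtain e where e: "\<And>p. 0 < e p" "\<And>p z. z \<in> facet (snd p) \<Longrightarrow> e p \<le> infdist z (A (fst p) (snd p))"
      by metis
    show thesis
    proof (rule that[of "Min (range e)"])
      show "0 < Min (range e)" using e(1) by simp
      fix j i :: 'r and z :: "real ^ 'r" assume "z \<in> facet i"
      then have "e (j, i) \<le> infdist z (A j i)" using e(2)[of z "(j, i)"] by simp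
      moreover have "Min (range e) \<le> e (j, i)" by (rule Min_le) auto
      ultimately show "Min (range e) \<le> infdist z (A j i)" by (rule order_trans[rotated])
    qed
  qed
  \<comment> \<open>\<open>e2\<close> is to bound from below every positive distance from a point of
    \<open>X\<close> to a preference set and every positive half-distance within \<open>X\<close>.
    The 1 inserted below keeps \<open>Min\<close> away from the empty set.\<close>
  define Y where "Y = (\<lambda>(x, j, i). infdist x (A j i)) ` (X \<times> UNIV) \<union> (\<lambda>(x, y). dist x y / 2) ` (X \<times> X)"
  have finY: "finite Y" using fin by (simp add: Y_def X_def)
  obtain e2 where e2: "0 < e2" "\<And>y. y \<in> Y \<Longrightarrow> 0 < y \<Longrightarrow> e2 \<le> y"
  proof (rule that[of "Min (insert 1 (Y \<inter> {0<..}))"])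
    show "0 < Min (insert 1 (Y \<inter> {0<..}))" using finY by simp
    show "Min (insert 1 (Y \<inter> {0<..})) \<le> y" if "y \<in> Y" "0 < y" for y
      using finY that by (intro Min_le) auto
  qed
  \<comment> \<open>Balls of radius \<open>\<delta>\<close> around the points of \<open>X\<close> are disjoint and avoid the facets.\<close>
  define \<delta> where "\<delta> = min e1 (e2 / 2)"
  have \<delta>: "0 < \<delta>" "\<delta> \<le> e1" "\<delta> \<le> e2 / 2" using e1(1) e2(1) by (auto simp: \<delta>_def)
  \<comment> \<open>Outside the balls no bijection is envy-free, so each one misses some preference
    set by a uniform margin; there are only finitely many bijections.\<close>
  obtain e3 where e3: "0 < e3"
    "\<And>\<pi> z. bij \<pi> \<Longrightarrow> z \<in> cuts \<Longrightarrow> (\<And>x. x \<in> X \<Longrightarrow> \<delta> \<le> dist z x) \<Longrightarrow> \<exists>j. e3 \<le> infdist z (A j (\<pi> j))"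
  proof -
    define K where "K = cuts \<inter> - (\<Union>x\<in>X. ball x \<delta>)"
    have K: "compact K" unfolding K_def using compact_cuts by (intro compact_Int_closed) auto
    have "\<exists>e>0. bij \<pi> \<longrightarrow> (\<forall>z\<in>K. \<exists>j. e \<le> infdist z (A j (\<pi> j)))" for \<pi>
    proof (cases "bij \<pi>")
      case True
      have "x \<in> ball x \<delta>" for x using \<delta> by simp
      then have "K \<inter> (\<Inter>j. A j (\<pi> j)) = {}" using XI[OF _ True] unfolding K_def by blast
      then obtain e where "0 < e" "\<And>z. z \<in> K \<Longrightarrow> \<exists>j. e \<le> infdist z (A j (\<pi> j))"
        using compact_infdist_lower_bound[OF K, of "\<lambda>j. A j (\<pi> j)"] closed ne by metis
      then show ?thesis by blast
    qed (auto intro: exI[of _ 1])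
    then obtain e where e: "\<And>\<pi>. 0 < e \<pi>" "\<And>\<pi> z. bij \<pi> \<Longrightarrow> z \<in> K \<Longrightarrow> \<exists>j. e \<pi> \<le> infdist z (A j (\<pi> j))"
      by metis
    show thesis
    proof (rule that[of "Min (range e)"])
      show "0 < Min (range e)" using e(1) by simp
      fix \<pi> :: "'r \<Rightarrow> 'r" and z :: "real ^ 'r"
      assume "bij \<pi>" "z \<in> cuts" "\<And>x. x \<in> X \<Longrightarrow> \<delta> \<le> dist z x"
      then have "z \<in> K" by (force simp: K_def dist_commute)
      then obtain j where "e \<pi> \<le> infdist z (A j (\<pi> j))" using e(2) \<open>bij \<pi>\<close> by blast
      moreover have "Min (range e) \<le> e \<pi>" by (rule Min_le) auto
      ultimately show "\<exists>j. Min (range e) \<le> infdist z (A j (\<pi> j))" using order_trans by blast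
    qed
  qed
  \<comment> \<open>The three bounds serve the facets (\<open>e1\<close>), the points near
    \<open>X\<close> (\<open>e2 / 2\<close>, the other half being used by \<open>\<delta>\<close>)
    and the points far from \<open>X\<close> (\<open>e3\<close>).\<close>
  define \<epsilon> where "\<epsilon> = min (min e1 (e2 / 2)) e3"
  have \<epsilon>: "0 < \<epsilon>" "\<epsilon> \<le> e1" "\<epsilon> \<le> e2 / 2" "\<epsilon> \<le> e3" using e1(1) e2(1) e3(1) by (auto simp: \<epsilon>_def)
  define w where "w j i z = max 0 (\<epsilon> - infdist z (A j i))" for j i z
  define W where "W j z = (\<Sum>i\<in>UNIV. w j i z)" for j z
  define f where "f z j i = w j i z / W j z" for z j i
  have w0: "0 \<le> w j i z" for j i z by (simp add: w_def)
  have W0: "0 < W j z" if z: "z \<in> cuts" for j z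
  proof -
    obtain i where "z \<in> A j i" using cover[of j] z by blast
    then have "0 < w j i z" using \<epsilon> by (simp add: w_def)
    then show ?thesis unfolding W_def using w0 by (intro sum_pos2[of _ i]) auto
  qed
  have f0: "0 \<le> f z j i" if "z \<in> cuts" for z j i
    using w0 W0[OF that] by (simp add: f_def less_imp_le)
  have fsupp: "infdist z (A j i) < \<epsilon>" if "f z j i \<noteq> 0" for z j i
    using that by (auto simp: f_def w_def max_def split: if_splits)
  have frow: "(\<Sum>i\<in>UNIV. f z j i) = 1" if "z \<in> cuts" for z j
    using W0[OF that, of j] by (simp add: f_def W_def flip: sum_divide_distrib)
  define b where "b x z = max 0 (\<delta> - dist z x)" for x z :: "real ^ 'r"
  \<comment> \<open>Column sums plus bumps that move mass from \<open>u x\<close> to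
    \<open>t x\<close>; by \<open>d0\<close> the total is unchanged.\<close>
  define c where "c z i = (\<Sum>j\<in>UNIV. f z j i) + (\<Sum>x\<in>X. b x z * d x i)" for z i
  have finX: "finite X" using fin X_def by simp
  have far: "c z i = (\<Sum>j\<in>UNIV. f z j i)" if "\<And>x. x \<in> X \<Longrightarrow> \<delta> \<le> dist z x" for z i
    using that by (simp add: c_def b_def)
  obtain z where z: "z \<in> cuts" "\<And>i. c z i = 1"
  proof (rule cuts_map_hits_ones)
    have "(\<Sum>i\<in>UNIV. max 0 (\<epsilon> - infdist z (A j i))) \<noteq> 0" if "z \<in> cuts" for j z
      using W0[OF that, of j] unfolding W_def w_def by simp
    then show "continuous_on cuts (\<lambda>z. c z i)" for i
      unfolding c_def b_def f_def W_def w_def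
      by (intro continuous_intros ballI) blast
    show "(\<Sum>i\<in>UNIV. c z i) = CARD('r)" if "z \<in> cuts" for z
    proof -
      have "(\<Sum>i\<in>UNIV. c z i) = (\<Sum>j\<in>UNIV. \<Sum>i\<in>UNIV. f z j i) + (\<Sum>x\<in>X. b x z * (\<Sum>i\<in>UNIV. d x i))"
        by (simp add: c_def sum.distrib sum_distrib_left sum.swap[of _ UNIV X] sum.swap[of "\<lambda>i j. f z j i"])
      then show ?thesis by (simp add: d0 frow that)
    qed
    show "c z i < 1" if zi: "z \<in> facet i" for z i
    proof -
      \<comment> \<open>An envy-free division gives tile \<open>i\<close> to some player
        \<open>j\<close>, so \<open>x\<close> lies in \<open>A j i\<close> and inherits its distance
        from the facet.\<close>
      have "\<delta> \<le> dist z x" if x: "x \<in> X" for x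
      proof -
        obtain j where "x \<in> A j i" using XD[OF x] by blast
        then have "infdist z (A j i) \<le> dist z x" by (rule infdist_le)
        then show ?thesis using e1(2)[OF zi, of j] \<delta> by simp
      qed
      moreover have "f z j i = 0" for j using fsupp[of z j i] e1(2)[OF zi, of j] \<epsilon> by force
      ultimately show ?thesis by (simp add: far)
    qed
  qed blast
  show False
  \<comment> \<open>Far from \<open>X\<close> there are no bumps, so \<open>f z\<close> is doubly
    stochastic and its support contains a matching, against \<open>e3\<close>. Near \<open>x\<close>
    the tight set \<open>S x\<close> is contradicted.\<close>
  proof (cases "\<forall>x\<in>X. \<delta> \<le> dist z x")
    case True
    then have "(\<Sum>j\<in>UNIV. f z j i) = 1" for i using far z(2) by force
    then obtain \<pi> where \<pi>: "bij \<pi>" "\<And>j. 0 < f z j (\<pi> j)"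
      using doubly_stochastic_support_matching[of "f z"] f0 frow z(1) by blast
    then obtain j where "e3 \<le> infdist z (A j (\<pi> j))" using e3(2) z(1) True by blast
    then show False using fsupp[of z j "\<pi> j"] \<pi>(2)[of j] \<epsilon>(4) by simp
  next
    case False
    then obtain x where x: "x \<in> X" "dist z x < \<delta>" by force
    have other: "b y z = 0" if "y \<in> X" "y \<noteq> x" for y
    proof -
      have "dist x y / 2 \<in> Y" using x that unfolding Y_def by force
      moreover have "0 < dist x y / 2" using that by simp
      ultimately have "e2 \<le> dist x y / 2" by (rule e2(2))
      then have "2 * \<delta> \<le> dist x y" using \<delta>(3) e2(1) by linarith
      then have "\<delta> \<le> dist z y" using x(2) dist_triangle[of x y z] dist_commute[of x z] by linarith
      then show ?thesis by (simp add: b_def)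
    qed
    have c: "c z i = (\<Sum>j\<in>UNIV. f z j i) + b x z * d x i" for i
    proof -
      have "(\<Sum>y\<in>X. b y z * d y i) = (\<Sum>y\<in>{x}. b y z * d y i)"
        using x(1) finX other by (intro sum.mono_neutral_right) auto
      then show ?thesis by (simp add: c_def)
    qed
    \<comment> \<open>A set missing \<open>x\<close> is at least \<open>e2\<close> away from
      \<open>x\<close>, hence more than \<open>e2 / 2\<close> away from \<open>z\<close>, outside
      the support of the weights.\<close>
    have fz: "f z j i = 0" if "x \<notin> A j i" for j i
    proof -
      have "infdist x (A j i) \<in> Y"
        unfolding Y_def by (rule UnI1, rule image_eqI[of _ _ "(x, j, i)"]) (simp_all add: x(1))
      moreover have "0 < infdist x (A j i)"
        using that in_closed_iff_infdist_zero[OF closed ne] infdist_nonneg by (metis order_less_le)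
      ultimately have "e2 \<le> infdist x (A j i)" by (intro e2(2))
      also have "\<dots> \<le> infdist z (A j i) + dist x z" by (rule infdist_triangle)
      finally have "\<epsilon> \<le> infdist z (A j i)" using x(2) \<delta>(3) \<epsilon>(3) dist_commute[of x z] by linarith
      then show ?thesis using fsupp[of z j i] by force
    qed
    \<comment> \<open>The rows in \<open>S x\<close> put all their mass into the columns
      \<open>T x\<close>, and the bump adds the positive amount \<open>b x z\<close>; yet these
      columns of \<open>c\<close> sum to only \<open>card (T x)\<close>.\<close>
    have "real (card (S x)) = (\<Sum>j\<in>S x. \<Sum>i\<in>UNIV. f z j i)" by (simp add: frow z(1))
    also have "\<dots> = (\<Sum>j\<in>S x. \<Sum>i\<in>T x. f z j i)"
      by (rule sum.cong[OF refl], rule sum.mono_neutral_right) (auto simp: T_def fz)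
    also have "\<dots> = (\<Sum>i\<in>T x. \<Sum>j\<in>S x. f z j i)" by (rule sum.swap)
    also have "\<dots> \<le> (\<Sum>i\<in>T x. \<Sum>j\<in>UNIV. f z j i)"
      by (intro sum_mono sum_mono2) (auto simp: f0 z(1))
    also have "\<dots> < (\<Sum>i\<in>T x. \<Sum>j\<in>UNIV. f z j i) + b x z * (\<Sum>i\<in>T x. d x i)"
      using x by (simp add: d1 b_def)
    also have "\<dots> = (\<Sum>i\<in>T x. c z i)" by (simp add: c sum.distrib sum_distrib_left)
    also have "\<dots> = card (T x)" by (simp add: z(2))
    finally show False using Stu(1)[OF x(1)] by (simp add: T_def)
  qed
qed

section \<open>From strict Hall to a cycle\<close>

text \<open>Fix the edge from \<open>j\<close> to \<open>i\<close>. Every nonempty set of other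
  players is proper, so its surplus absorbs the loss of \<open>i\<close> and Hall's theorem matches
  the rest.\<close>

lemma strict_hall_edge_in_matching:
  fixes E :: "'r::finite \<Rightarrow> 'r set"
  assumes strict: "\<And>S. S \<noteq> {} \<Longrightarrow> S \<noteq> UNIV \<Longrightarrow> card S < card (\<Union>(E ` S))"
    and i: "i \<in> E j"
  obtains \<pi> where "bij \<pi>" "\<And>k. \<pi> k \<in> E k" "\<pi> j = i"
proof -
  have "\<exists>f. inj_on f (UNIV - {j}) \<and> (\<forall>k\<in>UNIV - {j}. f k \<in> E k - {i})"
  proof (rule hall_marriage)
    fix K assume K: "K \<subseteq> UNIV - {j}"
    show "card K \<le> card (\<Union>k\<in>K. E k - {i})"
    proof (cases "K = {}")
      case False
      then have "card K < card (\<Union>(E ` K))" using strict K by blast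
      then show ?thesis by (rule card_le_card_UN_remove)
    qed simp
  qed auto
  then obtain f where f: "inj_on f (UNIV - {j})" "\<And>k. k \<noteq> j \<Longrightarrow> f k \<in> E k - {i}" by blast
  have "inj (f(j := i))"
  proof (rule injI)
    fix a b assume "(f(j := i)) a = (f(j := i)) b"
    then show "a = b"
      using f(2)[of a] f(2)[of b] inj_onD[OF f(1), of a b] by (auto split: if_splits)
  qed
  then have "bij (f(j := i))" using finite_UNIV_inj_surj[of "f(j := i)"] by (simp add: bij_def)
  moreover have "(f(j := i)) k \<in> E k" for k using f(2)[of k] i by auto
  ultimately show thesis using that by simp
qed

text \<open>The hypothesis \<open>connected\<close> says that the permutation \<open>\<tau>\<close>,
  inverse of \<pi> after \<sigma>, has a single orbit. Walking along \<sigma> to a tile and back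
  along \<pi> to a player therefore traverses the whole graph.\<close>

lemma two_matchings_cycle:
  fixes \<pi> \<sigma> :: "'r::finite \<Rightarrow> 'r"
  assumes card: "CARD('r) \<ge> 2" and bij: "bij \<pi>" "bij \<sigma>"
    and connected: "\<And>S. S \<noteq> {} \<Longrightarrow> \<sigma> ` S \<subseteq> \<pi> ` S \<Longrightarrow> S = UNIV"
  shows "is_cycle_graph (UNIV :: ('r + 'r) set) {{Inl j, Inr i} | j i. i = \<pi> j \<or> i = \<sigma> j}"
proof -
  let ?r = "CARD('r)"
  define \<tau> where "\<tau> = inv \<pi> \<circ> \<sigma>"
  have \<pi>\<tau>: "\<pi> (\<tau> y) = \<sigma> y" for y using bij(1) by (simp add: \<tau>_def bij_is_surj surj_f_inv_f)
  have \<tau>: "bij \<tau>" unfolding \<tau>_def using bij by (simp add: bij_comp bij_imp_bij_inv)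
  obtain j0 :: 'r where True by blast
  define p where "p k = (\<tau> ^^ k) j0" for k
  have p_Suc: "\<pi> (p (Suc k)) = \<sigma> (p k)" for k by (simp add: p_def \<pi>\<tau>)
  have range_p: "range p = UNIV"
  proof (rule connected)
    show "\<sigma> ` range p \<subseteq> \<pi> ` range p" 
    proof (clarsimp simp: image_image)
      fix k show "\<sigma> (p k) \<in> range (\<lambda>k. \<pi> (p k))" using p_Suc[of k] by (intro image_eqI[of _ _ "Suc k"]) auto
    qed
  qed simp
  \<comment> \<open>A return after \<open>n\<close> steps confines the orbit to \<open>n\<close>
    players, but the orbit is everything.\<close>
  have period: "?r \<le> n" if "0 < n" "p n = j0" for n
  proof -
    have "p m = p (m mod n)" for m
      using funpow_mod_eq[of n \<tau> j0 m] that by (simp add: p_def)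
    moreover have "m mod n \<in> {..<n}" for m using that(1) by simp
    ultimately have "range p \<subseteq> p ` {..<n}" by blast
    then have "?r \<le> card (p ` {..<n})" using range_p by (metis card_mono finite)
    also have "\<dots> \<le> n" using card_image_le[of "{..<n}" p] by simp
    finally show ?thesis .
  qed
  have diff: "p (b - a) = j0" if "a \<le> b" "p a = p b" for a b
  proof -
    have "(\<tau> ^^ a) (p (b - a)) = p b"
      using that(1) unfolding p_def by (metis add_diff_inverse_nat comp_apply funpow_add linorder_not_le)
    also have "\<dots> = (\<tau> ^^ a) j0" using that(2) by (simp add: p_def)
    finally show ?thesis using \<tau> by (meson bij_fn bij_is_inj injD)
  qed
  have neq: "p a \<noteq> p b" if "a < b" "b < ?r" for a b
    using period[of "b - a"] diff[of a b] that by auto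
  have inj: "inj_on p {..<?r}"
    by (rule linorder_inj_onI) (use neq in auto)
  have surj: "p ` {..<?r} = UNIV"
    using inj by (intro card_subset_eq) (auto simp: card_image)
  obtain m where m: "m < ?r" "p ?r = p m" using surj by (metis UNIV_I imageE lessThan_iff)
  \<comment> \<open>The walk closes exactly at its start: \<open>p ?r = p m\<close> gives a return
    after \<open>?r - m\<close> steps, and \<open>period\<close> forces
    \<open>m = 0\<close>.\<close>
  have p_r: "p ?r = j0"
    using diff[of m ?r] period[of "?r - m"] m by (cases "m = 0") (auto simp: p_def)
  \<comment> \<open>The alternating walk: players at even positions, each followed by its tile under
    \<sigma>.\<close>
  define g :: "nat \<Rightarrow> 'r + 'r" where
    "g k = (if even k then Inl (p (k div 2)) else Inr (\<sigma> (p (k div 2))))" for k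
  have g_even: "g (2 * k) = Inl (p k)" and g_odd: "g (Suc (2 * k)) = Inr (\<sigma> (p k))" for k
    by (simp_all add: g_def)
  have g_mod: "g (Suc k mod (2 * ?r)) = g (Suc k)" if "k < 2 * ?r" for k
  proof (cases "Suc k = 2 * ?r")
    case True
    have "g (2 * ?r) = g 0" using p_r by (simp add: g_def p_def)
    then show ?thesis using True by simp
  qed (use that in simp)
  have p_surj: "\<exists>k<?r. y = p k" for y using surj by (metis UNIV_I imageE lessThan_iff)
  define vs where "vs = map g [0..<2 * ?r]"
  have len: "length vs = 2 * ?r" by (simp add: vs_def)
  have "inj_on g {0..<2 * ?r}"
  proof (rule inj_onI)
    fix a b assume ab: "a \<in> {0..<2 * ?r}" "b \<in> {0..<2 * ?r}" "g a = g b"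
    have "even a = even b" "p (a div 2) = p (b div 2)"
      using ab(3) bij(2) by (auto simp: g_def bij_is_inj inj_eq split: if_splits)
    moreover have "a div 2 = b div 2"
      using inj_onD[OF inj, of "a div 2" "b div 2"] ab(1,2) calculation(2) by auto
    ultimately show "a = b" by (metis dvd_mult_div_cancel odd_two_times_div_two_succ)
  qed
  then have dist: "distinct vs" by (simp add: vs_def distinct_map)
  have set: "set vs = UNIV"
  proof -
    have "y \<in> g ` {0..<2 * ?r}" for y
    proof (cases y)
      case (Inl j)
      obtain k where "k < ?r" "j = p k" using p_surj by blast
      then show ?thesis using Inl g_even[of k] by (intro image_eqI[of _ _ "2 * k"]) auto
    next
      case (Inr i)
      obtain k where "k < ?r" "inv \<sigma> i = p k" using p_surj by blast
      then show ?thesis using Inr g_odd[of k] bij(2)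
        by (intro image_eqI[of _ _ "Suc (2 * k)"]) (auto simp: bij_is_surj surj_f_inv_f dest!: sym[of "inv \<sigma> i"])
    qed
    then show ?thesis by (auto simp: vs_def)
  qed
  have edges: "{{Inl j, Inr i} | j i. i = \<pi> j \<or> i = \<sigma> j} = {{vs ! k, vs ! (Suc k mod length vs)} | k. k < length vs}"
    (is "?L = ?R")
  proof -
    have R: "?R = {{g k, g (Suc k)} | k. k < 2 * ?r}"
    proof -
      have nth: "{vs ! k, vs ! (Suc k mod length vs)} = {g k, g (Suc k)}" if "k < 2 * ?r" for k
      proof -
        have "Suc k mod (2 * ?r) < 2 * ?r" using that by (intro mod_less_divisor) auto
        then show ?thesis using that g_mod[OF that] by (simp add: vs_def)
      qed
      then show ?thesis using len by (intro Collect_cong) metis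
    qed
    have "e \<in> ?L" if e: "e \<in> ?R" for e
    proof -
      obtain k where k: "e = {g k, g (Suc k)}" using e unfolding R by blast
      show ?thesis
      proof (cases "even k")
        case True
        then obtain l where "k = 2 * l" by blast
        then show ?thesis using k g_even[of l] g_odd[of l] by auto
      next
        case False
        then obtain l where "k = Suc (2 * l)" by (metis oddE Suc_eq_plus1)
        then have "e = {Inl (p (Suc l)), Inr (\<pi> (p (Suc l)))}"
          using k g_even[of "Suc l"] g_odd[of l] p_Suc[of l] by auto
        then show ?thesis by blast
      qed
    qed
    moreover have "{Inl j, Inr i} \<in> ?R" if "i = \<pi> j \<or> i = \<sigma> j" for j i
      using that
    proof
      assume i: "i = \<sigma> j"
      obtain k where "k < ?r" "j = p k" using p_surj by blast
      then have "{Inl j, Inr i} = {g (2 * k), g (Suc (2 * k))}" "2 * k < 2 * ?r"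
        using i g_even[of k] g_odd[of k] by auto
      then show ?thesis unfolding R by blast
    next
      assume i: "i = \<pi> j"
      \<comment> \<open>The \<pi>-edge at \<open>j\<close> is the one by which the walk enters
        \<open>j\<close>, so \<open>j\<close> needs a predecessor; for \<open>j0\<close> it is
        \<open>p (?r - 1)\<close>, on the closing edge.\<close>
      obtain k where k: "k < ?r" "j = p (Suc k)"
      proof -
        obtain l where l: "l < ?r" "j = p l" using p_surj by blast
        show thesis
        proof (cases l)
          case 0
          then show thesis using that[of "?r - 1"] l p_r by (simp add: p_def)
        next
          case (Suc l')
          then show thesis using that[of l'] l by simp
        qed
      qed
      then have "{Inl j, Inr i} = {g (Suc (2 * k)), g (Suc (Suc (2 * k)))}" "Suc (2 * k) < 2 * ?r"
        using i g_even[of "Suc k"] g_odd[of k] p_Suc[of k] by auto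
      then show ?thesis unfolding R by blast
    qed
    ultimately show ?thesis by blast
  qed
  have "3 \<le> length vs" using len card by simp
  with dist set edges show ?thesis unfolding is_cycle_graph_def by blast
qed

text \<open>Only an upper bound is assumed since the two envy-free divisions might belong to
  different cuts. Two edges at one player extend to two different matchings, so the bound is
  attained and every edge lies in one of them.\<close>

lemma strict_hall_two_matchings_cycle:
  fixes E :: "'r::finite \<Rightarrow> 'r set"
  assumes card: "CARD('r) \<ge> 2"
    and strict: "\<And>S. S \<noteq> {} \<Longrightarrow> S \<noteq> UNIV \<Longrightarrow> card S < card (\<Union>(E ` S))"
    and at_most: "card {\<pi>. bij \<pi> \<and> (\<forall>j. \<pi> j \<in> E j)} \<le> 2"
  shows "card {\<pi>. bij \<pi> \<and> (\<forall>j. \<pi> j \<in> E j)} = 2"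
    and "is_cycle_graph (UNIV :: ('r + 'r) set) {{Inl j, Inr i} | j i. i \<in> E j}"
proof -
  let ?M = "{\<pi>. bij \<pi> \<and> (\<forall>j. \<pi> j \<in> E j)}"
  have degree: "2 \<le> card (E j)" for j
  proof -
    have "{j} \<noteq> UNIV"
    proof
      assume "{j} = UNIV"
      then have "CARD('r) = card {j}" by simp
      then show False using card by simp
    qed
    then show ?thesis using strict[of "{j}"] by simp
  qed
  have edge: "\<exists>\<pi>\<in>?M. \<pi> j = i" if "i \<in> E j" for i j
    using strict_hall_edge_in_matching[OF strict that] by auto
  obtain j0 :: 'r where True by blast
  have "\<not> card (E j0) \<le> 1" using degree[of j0] by simp
  then obtain i1 i2 where i12: "i1 \<in> E j0" "i2 \<in> E j0" "i1 \<noteq> i2"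
    by (metis card_le_Suc0_iff_eq finite One_nat_def)
  obtain \<pi> where \<pi>: "\<pi> \<in> ?M" "\<pi> j0 = i1" using edge[OF i12(1)] by blast
  obtain \<sigma> where \<sigma>: "\<sigma> \<in> ?M" "\<sigma> j0 = i2" using edge[OF i12(2)] by blast
  have \<pi>\<sigma>: "\<pi> \<in> ?M" "\<sigma> \<in> ?M" "\<pi> \<noteq> \<sigma>" using \<pi> \<sigma> i12(3) by auto
  have M: "?M = {\<pi>, \<sigma>}"
    using \<pi>\<sigma> at_most by (intro card_seteq[symmetric]) auto
  then show "card ?M = 2" using \<pi>\<sigma>(3) by simp
  have E: "i \<in> E j \<longleftrightarrow> i = \<pi> j \<or> i = \<sigma> j" for i j
  proof
    show "i \<in> E j \<Longrightarrow> i = \<pi> j \<or> i = \<sigma> j" using edge[of i j] unfolding M by blast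
    show "i = \<pi> j \<or> i = \<sigma> j \<Longrightarrow> i \<in> E j" using \<pi>\<sigma>(1,2) by blast
  qed
  have "S = UNIV" if "S \<noteq> {}" "\<sigma> ` S \<subseteq> \<pi> ` S" for S
  proof (rule ccontr)
    assume "S \<noteq> UNIV"
    then have "card S < card (\<Union>(E ` S))" using strict that(1) by blast
    moreover have "\<Union>(E ` S) \<subseteq> \<pi> ` S" using that(2) E by blast
    then have "card (\<Union>(E ` S)) \<le> card S" by (meson card_image_le card_mono finite order_trans)
    ultimately show False by simp
  qed
  then show "is_cycle_graph (UNIV :: ('r + 'r) set) {{Inl j, Inr i} | j i. i \<in> E j}"
    using two_matchings_cycle[OF card, of \<pi> \<sigma>] \<pi>\<sigma>(1,2) unfolding E by auto
qed

theorem theorem3p4: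
  fixes A :: "('r::finite) preferences" and x :: "real ^ 'r"
  assumes "CARD('r) \<ge> 2"
    and "preferences A"
    and "extremal A"
    and "\<And>j i. closed (A j i)"
    and "\<And>j. (\<Union>i. A j i) = cuts"
    and "\<And>j i. A j i \<inter> facet i = {}"
    and "admits_envy_free_allocation A x"
  shows "is_cycle_graph (UNIV :: ('r + 'r) set) (preference_edges A x)"
proof -
  let ?D = "envy_free_divisions A"
  have D2: "card ?D = 2" using assms(3) by (simp add: extremal_def)
  then have finD: "finite ?D" using card.infinite by fastforce
  have "{y. admits_envy_free_allocation A y} = fst ` ?D"
    by (force simp: admits_envy_free_allocation_def)
  then have "finite {y. admits_envy_free_allocation A y}" using finD by simp
  then obtain y where y: "admits_envy_free_allocation A y"
    and strict: "\<And>S. S \<noteq> {} \<Longrightarrow> S \<noteq> UNIV \<Longrightarrow> card S < card (\<Union>j\<in>S. {i. y \<in> A j i})"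
    using ex_cut_strict_hall[of A] assms(4-6) by metis
  let ?M = "{\<pi>. bij \<pi> \<and> (\<forall>j. \<pi> j \<in> {i. y \<in> A j i})}"
  have "y \<in> cuts" using y by (auto simp: admits_envy_free_allocation_def envy_free_divisions_def)
  then have sub: "Pair y ` ?M \<subseteq> ?D" by (auto simp: envy_free_divisions_def)
  have card_M: "card (Pair y ` ?M) = card ?M" by (rule card_image) (simp add: inj_on_def)
  have "card ?M \<le> 2" using card_mono[OF finD sub] card_M D2 by simp
  note cycle = strict_hall_two_matchings_cycle[OF assms(1) strict this]
  \<comment> \<open>The matchings at \<open>y\<close> already account for both divisions, so no
    other cut admits one and \<open>x\<close> must be \<open>y\<close>.\<close>
  have "Pair y ` ?M = ?D" using card_subset_eq[OF finD sub] card_M cycle(1) D2 by simp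
  then have "x = y" using assms(7) unfolding admits_envy_free_allocation_def by blast
  then show ?thesis using cycle(2) by (simp add: preference_edges_def)
qed

end
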